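(* Let $n\ge2$. For any collection $X_1,\dots,X_n$ of random variables and any $i\neq j$ in $\{1,\dots,n\}$, $$R(X_1,\dots,X_n)\le I(X_i;X_j),$$ and consequently $$R(X_1,\dots,X_n)\le\min_{i\neq j}I(X_i;X_j).$$
   Context: Mutual information $I(\cdot;\cdot)$ is measured in bits. $A-B-C$ means that $A,B,C$ form a Markov chain ($A$ and $C$ conditionally independent given $B$). Definition of the higher-order common information (HCI). Let $n\ge2$ and let $\mathcal X=\{X_1,\dots,X_n\}$ be arbitrarily distributed random variables; in $I(\cdot;\mathcal X)$ and in Markov chains, $\mathcal X$ stands for the joint vector $(X_1,\dots,X_n)$. Fix $i\in\{1,\dots,n\}$ and let $\pi^{(i)}$ be an ordering (permutation) of $\{1,\dots,n\}\setminus\{i\}$, with $\pi^{(i)}(\ell)$ its $\ell$-th element, $\ell=1,\dots,n-1$. Set $T_1^{(i)}=X_i$. For $\ell=1,\dots,n-2$ and given $T_\ell^{(i)}$, let $\mathcal A_\ell(T_\ell^{(i)},\pi^{(i)})$ be the set of minimizers $$\arg\inf_{S:\,S-T_\ell^{(i)}-\mathcal X} I(S;\mathcal X)\quad\text{subject to}\quad I(S;T_\ell^{(i)})=I(T_\ell^{(i)};X_{\pi^{(i)}(\ell)}).$$ Here $S$ ranges over deterministic or stochastic functions of $T_\ell^{(i)}$, i.e. $S=f(T_\ell^{(i)},\epsilon)$ with auxiliary randomness $\epsilon$ independent of $(X_1,\dots,X_n)$ and such that the Markov chain holds. Let $\mathcal T_i^{\pi^{(i)}}(\mathcal X)$ be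 the set of all terminal auxiliaries $T_{n-1}^{(i)}$ obtained from sequences with $T_1^{(i)}=X_i$ and $T_{\ell+1}^{(i)}\in\mathcal A_\ell(T_\ell^{(i)},\pi^{(i)})$ for $\ell=1,\dots,n-2$, and let $\mathcal T_i(\mathcal X)=\bigcup_{\pi^{(i)}}\mathcal T_i^{\pi^{(i)}}(\mathcal X)$, the union over all orderings. Then $$R(X_1,\dots,X_n)=\min_{1\le i\le n}\;\sup_{T\in\mathcal T_i(\mathcal X)}\;\min_{1\le j\le n} I(T;X_j).$$ *)

theory Defs
  imports "HOL-Probability.Probability"
begin

section \<open>Mutual information and Markov chains for arbitrary random variables\<close>

text \<open>
  The library's mutual information is a Bochner integral and hence real-valued, with junk value 0
  when the integral diverges. Since the negative part of
  \<open>log 2 (dP/dQ)\<close> is always \<open>P\<close>-integrable, \<open>D(P || Q)\<close> is finite exactly if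
  \<open>P\<close> is absolutely continuous w.r.t. \<open>Q\<close> and the entropy density is \<open>P\<close>-integrable.
\<close>

definition mutual_info ::
  "'w measure \<Rightarrow> 'x measure \<Rightarrow> 'y measure \<Rightarrow> ('w \<Rightarrow> 'x) \<Rightarrow> ('w \<Rightarrow> 'y) \<Rightarrow> ennreal"
  where
  "mutual_info M K L Y Z =
    (let P = distr M (K \<Otimes>\<^sub>M L) (\<lambda>w. (Y w, Z w));
         Q = distr M K Y \<Otimes>\<^sub>M distr M L Z
     in if absolutely_continuous Q P \<and> integrable P (entropy_density 2 Q P)
        then ennreal (prob_space.mutual_information M 2 K L Y Z)
        else \<infinity>)"

definition cond_prob_given ::
  "'w measure \<Rightarrow> 't measure \<Rightarrow> ('w \<Rightarrow> 't) \<Rightarrow> 'w set \<Rightarrow> 'w \<Rightarrow> real"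
  where
  "cond_prob_given M K T A = real_cond_exp M (vimage_algebra (space M) T K) (indicator A)"

text \<open>\<open>Y - T - Z\<close>: \<open>Y\<close> and \<open>Z\<close> are conditionally independent given \<open>T\<close>.\<close>

definition markov_chain ::
  "'w measure \<Rightarrow> 'y measure \<Rightarrow> 't measure \<Rightarrow> 'z measure
    \<Rightarrow> ('w \<Rightarrow> 'y) \<Rightarrow> ('w \<Rightarrow> 't) \<Rightarrow> ('w \<Rightarrow> 'z) \<Rightarrow> bool"
  where
  "markov_chain M K L N Y T Z \<longleftrightarrow>
    (\<forall>A\<in>sets K. \<forall>B\<in>sets N.
      AE w in M.
        cond_prob_given M L T ((Y -` A \<inter> space M) \<inter> (Z -` B \<inter> space M)) w
        = cond_prob_given M L T (Y -` A \<inter> space M) w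
          * cond_prob_given M L T (Z -` B \<inter> space M) w)"

text \<open>The library's \<open>indep_var\<close> requires both variables to have values in the same type.\<close>

definition indep_rvs ::
  "'w measure \<Rightarrow> 'y measure \<Rightarrow> 'z measure \<Rightarrow> ('w \<Rightarrow> 'y) \<Rightarrow> ('w \<Rightarrow> 'z) \<Rightarrow> bool"
  where
  "indep_rvs M K L Y Z \<longleftrightarrow>
    prob_space.indep_set M
      (sets (vimage_algebra (space M) Y K)) (sets (vimage_algebra (space M) Z L))"

section \<open>Higher-order common information\<close>

text \<open>
  A given probability space need not carry any randomness beyond the \<open>X k\<close>, so the auxiliary
  variables live on its product with a sequence of independent uniform variables on \<open>[0,1]\<close>.
\<close>

definition noise :: "(nat \<Rightarrow> real) measure"
  where "noise = PiM UNIV (\<lambda>_. uniform_measure lborel {0..1})"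

definition ext_space :: "'a measure \<Rightarrow> ('a \<times> (nat \<Rightarrow> real)) measure"
  where "ext_space M = M \<Otimes>\<^sub>M noise"

definition lift_rv :: "('a \<Rightarrow> 'b) \<Rightarrow> 'a \<times> (nat \<Rightarrow> real) \<Rightarrow> 'b"
  where "lift_rv Y = (\<lambda>(w, u). Y w)"

definition joint_space :: "nat \<Rightarrow> (nat \<Rightarrow> 'b::topological_space) measure"
  where "joint_space n = PiM {1..n} (\<lambda>_. borel)"

definition joint_rv ::
  "nat \<Rightarrow> (nat \<Rightarrow> 'a \<Rightarrow> 'b) \<Rightarrow> 'a \<times> (nat \<Rightarrow> real) \<Rightarrow> nat \<Rightarrow> 'b"
  where "joint_rv n X = (\<lambda>w. \<lambda>k\<in>{1..n}. lift_rv (X k) w)"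

text \<open>
  The alphabet of all the \<open>X k\<close> and of all auxiliaries is one Polish space \<open>'b\<close>. An uncountable one
  (e.g. the reals) contains a Borel isomorphic copy of every standard Borel space, so that a common
  alphabet restricts neither the \<open>X k\<close> nor the range of the auxiliaries; for a countable \<open>'b\<close> the
  auxiliaries are restricted to that alphabet.

  The auxiliary randomness \<open>\<epsilon>\<close> of stage \<open>l\<close> may be any random variable on the extension that
  depends on the first \<open>l\<close> uniform variables only. Then \<open>T\<^sub>l\<close> depends on the first \<open>l - 1\<close> only, so
  that at each stage fresh randomness, independent of \<open>(T\<^sub>l, X\<^sub>1, \<dots>, X\<^sub>n)\<close>, is still available
  and every stochastic function of \<open>T\<^sub>l\<close> is realized.
\<close>

definition stoch_fun ::
  "'a measure \<Rightarrow> nat \<Rightarrow> (nat \<Rightarrow> 'a \<Rightarrow> 'b::polish_space) \<Rightarrow> nat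
    \<Rightarrow> ('a \<times> (nat \<Rightarrow> real) \<Rightarrow> 'b) \<Rightarrow> ('a \<times> (nat \<Rightarrow> real) \<Rightarrow> 'b) \<Rightarrow> bool"
  where
  "stoch_fun M n X l T S \<longleftrightarrow>
    (\<exists>f \<epsilon> h.
      f \<in> borel_measurable (borel \<Otimes>\<^sub>M (borel :: real measure)) \<and>
      h \<in> borel_measurable (M \<Otimes>\<^sub>M PiM {1..l} (\<lambda>_. borel :: real measure)) \<and>
      \<epsilon> = (\<lambda>(w, u). h (w, restrict u {1..l})) \<and>
      indep_rvs (ext_space M) (borel :: real measure) (joint_space n) \<epsilon> (joint_rv n X) \<and>
      S = (\<lambda>w. f (T w, \<epsilon> w)))"

definition feasible ::
  "'a measure \<Rightarrow> nat \<Rightarrow> (nat \<Rightarrow> 'a \<Rightarrow> 'b::polish_space) \<Rightarrow> nat \<Rightarrow> (nat \<Rightarrow> nat)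
    \<Rightarrow> ('a \<times> (nat \<Rightarrow> real) \<Rightarrow> 'b) \<Rightarrow> ('a \<times> (nat \<Rightarrow> real) \<Rightarrow> 'b) \<Rightarrow> bool"
  where
  "feasible M n X l \<pi> T S \<longleftrightarrow>
    stoch_fun M n X l T S \<and>
    markov_chain (ext_space M) borel borel (joint_space n) S T (joint_rv n X) \<and>
    mutual_info (ext_space M) borel borel S T
      = mutual_info (ext_space M) borel borel T (lift_rv (X (\<pi> l)))"

definition minimizers ::
  "'a measure \<Rightarrow> nat \<Rightarrow> (nat \<Rightarrow> 'a \<Rightarrow> 'b::polish_space) \<Rightarrow> nat \<Rightarrow> (nat \<Rightarrow> nat)
    \<Rightarrow> ('a \<times> (nat \<Rightarrow> real) \<Rightarrow> 'b) \<Rightarrow> ('a \<times> (nat \<Rightarrow> real) \<Rightarrow> 'b) set"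
  where
  "minimizers M n X l \<pi> T =
    {S. is_arg_min (\<lambda>S. mutual_info (ext_space M) borel (joint_space n) S (joint_rv n X))
          (feasible M n X l \<pi> T) S}"

definition terminal_aux_ord ::
  "'a measure \<Rightarrow> nat \<Rightarrow> (nat \<Rightarrow> 'a \<Rightarrow> 'b::polish_space) \<Rightarrow> nat \<Rightarrow> (nat \<Rightarrow> nat)
    \<Rightarrow> ('a \<times> (nat \<Rightarrow> real) \<Rightarrow> 'b) set"
  where
  "terminal_aux_ord M n X i \<pi> =
    {T (n - 1) | T :: nat \<Rightarrow> 'a \<times> (nat \<Rightarrow> real) \<Rightarrow> 'b.
       T 1 = lift_rv (X i) \<and> (\<forall>l\<in>{1..n-2}. T (l + 1) \<in> minimizers M n X l \<pi> (T l))}"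

definition terminal_aux ::
  "'a measure \<Rightarrow> nat \<Rightarrow> (nat \<Rightarrow> 'a \<Rightarrow> 'b::polish_space) \<Rightarrow> nat
    \<Rightarrow> ('a \<times> (nat \<Rightarrow> real) \<Rightarrow> 'b) set"
  where
  "terminal_aux M n X i =
    (\<Union>\<pi>\<in>{\<pi>. bij_betw \<pi> {1..n-1} ({1..n} - {i})}. terminal_aux_ord M n X i \<pi>)"

text \<open>If there is no terminal auxiliary, the supremum below is 0, the bottom of \<open>ennreal\<close>.\<close>

definition HCI :: "'a measure \<Rightarrow> nat \<Rightarrow> (nat \<Rightarrow> 'a \<Rightarrow> 'b::polish_space) \<Rightarrow> ennreal"
  where
  "HCI M n X =
    (MIN i\<in>{1..n}. SUP T\<in>terminal_aux M n X i.
       MIN j\<in>{1..n}. mutual_info (ext_space M) borel borel T (lift_rv (X j)))"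

end

theory Submission
  imports Defs
begin

text \<open>Each stage of the construction is a Markov chain \<open>T\<^sub>l\<^sub>+\<^sub>1 - T\<^sub>l - X\<^sub>j\<close>, so data processing gives
  \<open>I(T\<^sub>n\<^sub>-\<^sub>1; X\<^sub>j) \<le> \<dots> \<le> I(T\<^sub>1; X\<^sub>j) = I(X\<^sub>i; X\<^sub>j)\<close> for every terminal auxiliary started at \<open>X\<^sub>i\<close>.\<close>

section \<open>Joint laws and conditional probabilities along a Markov chain\<close>

lemma finite_measure_pair_eqI:
  assumes \<mu>: "finite_measure \<mu>" "sets \<mu> = sets (A \<Otimes>\<^sub>M B)" and \<nu>: "sets \<nu> = sets (A \<Otimes>\<^sub>M B)"
    and eq: "\<And>a b. a \<in> sets A \<Longrightarrow> b \<in> sets B \<Longrightarrow> emeasure \<mu> (a \<times> b) = emeasure \<nu> (a \<times> b)"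
  shows "\<mu> = \<nu>"
proof -
  interpret finite_measure \<mu> by fact
  show ?thesis
  proof (rule measure_eqI_generator_eq[OF Int_stable_pair_measure_generator[of A B],
        where \<Omega>="space A \<times> space B" and A="\<lambda>_. space A \<times> space B"])
    show "{a \<times> b |a b. a \<in> sets A \<and> b \<in> sets B} \<subseteq> Pow (space A \<times> space B)"
      by (auto dest: sets.sets_into_space)
    show "emeasure \<mu> (space A \<times> space B) \<noteq> \<infinity>" for i :: nat
      using emeasure_finite by simp
  qed (use \<mu>(2) \<nu> eq in \<open>auto simp: sets_pair_measure\<close>)
qed

text \<open>Opens the theory of \<open>real_cond_exp\<close> for the sigma-algebra generated by
  \<open>T\<close>, over which \<open>cond_prob_given\<close> conditions.\<close>

lemma finite_measure_subalgebra_vimage: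
  assumes "finite_measure M" and [measurable]: "T \<in> M \<rightarrow>\<^sub>M L"
  shows "finite_measure_subalgebra M (vimage_algebra (space M) T L)"
  unfolding finite_measure_subalgebra_def finite_measure_subalgebra_axioms_def subalgebra_def
  using assms by (auto simp: sets_vimage_algebra2[OF measurable_space[OF assms(2), THEN funcsetI]])

text \<open>Here \<open>k t\<close> is a version of \<open>P(Z \<in> C | T = t)\<close>; along a Markov chain it is also one of
  \<open>P(Z \<in> C | Y = y, T = t)\<close>.\<close>

lemma (in prob_space) markov_chain_cond_integral:
  assumes Y[measurable]: "Y \<in> M \<rightarrow>\<^sub>M K" and T[measurable]: "T \<in> M \<rightarrow>\<^sub>M L" and Z[measurable]: "Z \<in> M \<rightarrow>\<^sub>M N"
    and markov: "markov_chain M K L N Y T Z"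
    and k[measurable]: "k \<in> borel_measurable L"
    and k_eq: "\<And>B. B \<in> sets L \<Longrightarrow>
      (\<integral>\<^sup>+w. k (T w) * indicator B (T w) \<partial>M) = emeasure M {w\<in>space M. T w \<in> B \<and> Z w \<in> C}"
    and A[measurable]: "A \<in> sets K" and B[measurable]: "B \<in> sets L" and C[measurable]: "C \<in> sets N"
  shows "(\<integral>\<^sup>+w. k (T w) * indicator A (Y w) * indicator B (T w) \<partial>M) =
    emeasure M {w\<in>space M. Y w \<in> A \<and> T w \<in> B \<and> Z w \<in> C}"
proof -
  let ?F = "vimage_algebra (space M) T L"
  interpret F: finite_measure_subalgebra M ?F
    by (rule finite_measure_subalgebra_vimage) (auto intro: finite_measure_axioms)
  have T_F[measurable]: "T \<in> ?F \<rightarrow>\<^sub>M L"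
    by (rule measurable_vimage_algebra1) (use T[THEN measurable_space] in auto)
  \<comment> \<open>\<open>real_cond_exp\<close> is real-valued while \<open>k\<close> takes values
    in \<open>ennreal\<close>, so a real version is needed. Nothing is lost: \<open>k_eq\<close>
    with \<open>B = space L\<close> bounds the expectation of \<open>k (T w)\<close> by a
    probability, so \<open>k (T w)\<close> is finite almost everywhere.\<close>
  define r where "r w = enn2real (k (T w))" for w
  have r_F[measurable]: "r \<in> borel_measurable ?F"
    unfolding r_def by measurable
  have r_M[measurable]: "r \<in> borel_measurable M"
    unfolding r_def by measurable
  have "(\<integral>\<^sup>+w. k (T w) \<partial>M) = (\<integral>\<^sup>+w. k (T w) * indicator (space L) (T w) \<partial>M)"
    by (intro nn_integral_cong) (use T[THEN measurable_space] in auto)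
  also have "\<dots> < \<infinity>"
    by (subst k_eq) (auto simp: less_top[symmetric])
  finally have fin: "(\<integral>\<^sup>+w. k (T w) \<partial>M) < \<infinity>" .
  then have "AE w in M. k (T w) \<noteq> \<infinity>"
    by (intro nn_integral_PInf_AE) auto
  then have r_eq: "AE w in M. ennreal (r w) = k (T w)"
    by eventually_elim (simp add: r_def less_top)
  have r_int: "integrable M r"
  proof (rule integrableI_nonneg)
    show "(\<integral>\<^sup>+w. ennreal (r w) \<partial>M) < \<infinity>"
      using fin nn_integral_cong_AE[OF r_eq] by simp
  qed (auto simp: r_def)
  have r_int_ind: "integrable M (\<lambda>w. r w * indicator D w)" if "D \<in> sets M" for D
    using integrable_mult_indicator[OF that r_int] by (simp add: mult.commute)
  let ?A = "Y -` A \<inter> space M" and ?C = "Z -` C \<inter> space M"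
  \<comment> \<open>Sets of \<open>?F\<close> are preimages under \<open>T\<close>, so
    \<open>k_eq\<close> is exactly the defining property of the conditional probability of
    \<open>?C\<close> given \<open>T\<close>.\<close>
  have cond: "AE w in M. real_cond_exp M ?F (indicator ?C) w = r w"
  proof (rule F.real_cond_exp_charact[OF _ _ r_int r_F])
    fix D assume "D \<in> sets ?F"
    then obtain B' where B'[measurable]: "B' \<in> sets L" and D: "D = T -` B' \<inter> space M"
      using T[THEN measurable_space] by (auto simp: sets_vimage_algebra2)
    have [measurable]: "D \<in> sets M"
      unfolding D by measurable
    have "ennreal (\<integral>w. r w * indicator D w \<partial>M) = (\<integral>\<^sup>+w. ennreal (r w * indicator D w) \<partial>M)"
      by (intro nn_integral_eq_integral[symmetric] r_int_ind) (auto simp: r_def)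
    also have "\<dots> = (\<integral>\<^sup>+w. k (T w) * indicator B' (T w) \<partial>M)"
      by (rule nn_integral_cong_AE, use r_eq AE_space in eventually_elim) (auto simp: D indicator_def)
    also have "\<dots> = emeasure M (D \<inter> ?C)"
      by (subst k_eq) (auto simp: D intro!: arg_cong[where f="emeasure M"])
    finally have "(\<integral>w. r w * indicator D w \<partial>M) = measure M (D \<inter> ?C)"
      by (simp add: emeasure_eq_measure r_def integral_nonneg)
    then show "(\<integral>w\<in>D. indicator ?C w \<partial>M) = (\<integral>w\<in>D. r w \<partial>M)"
      by (simp add: set_lebesgue_integral_def mult.commute indicator_inter_arith[symmetric])
  next
    show "integrable M (indicat_real ?C)"
      by (rule integrable_real_indicator) (auto simp: less_top[symmetric])
  qed
  have mk: "AE w in M. real_cond_exp M ?F (indicator (?A \<inter> ?C)) w =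
      real_cond_exp M ?F (indicator ?A) w * real_cond_exp M ?F (indicator ?C) w"
    using markov A C by (auto simp: markov_chain_def cond_prob_given_def)
  \<comment> \<open>With \<open>b\<close> for \<open>?b\<close>, \<open>A\<close> and
    \<open>C\<close> for the events \<open>?A\<close> and \<open>?C\<close>, and conditional
    probabilities given \<open>T\<close>, the chain is \<open>E[b r 1_A] = E[b r P(A|T)] =
    E[b P(A Int C|T)] = E[b 1_(A Int C)]\<close>. The outer equalities hold because \<open>b\<close>
    and \<open>r\<close> are \<open>?F\<close>-measurable, the middle one by the Markov property
    with \<open>r = P(C|T)\<close>.\<close>
  let ?b = "\<lambda>w. indicator B (T w) :: real"
  have b_F: "?b \<in> borel_measurable ?F" by measurable
  let ?D = "{w\<in>space M. Y w \<in> A \<and> T w \<in> B}"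
  have D_eq: "w \<in> space M \<Longrightarrow> (?b w * r w) * indicator ?A w = r w * indicator ?D w" for w
    by (auto simp: indicator_def)
  have int1: "integrable M (\<lambda>w. (?b w * r w) * indicator ?A w)"
    by (subst Bochner_Integration.integrable_cong[OF refl D_eq]) (auto intro!: r_int_ind)
  have int2: "integrable M (\<lambda>w. ?b w * indicator (?A \<inter> ?C) w)"
    by (rule integrable_const_bound[where B=1]) (auto simp: indicator_def)
  have "(\<integral>w. (?b w * r w) * indicator ?A w \<partial>M) =
      (\<integral>w. (?b w * r w) * real_cond_exp M ?F (indicator ?A) w \<partial>M)"
    by (rule F.real_cond_exp_intg(2)[symmetric]) (use int1 in auto)
  also have "\<dots> = (\<integral>w. ?b w * real_cond_exp M ?F (indicator (?A \<inter> ?C)) w \<partial>M)"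
    by (rule integral_cong_AE; (measurable; fail)?) (use mk cond in \<open>eventually_elim, auto\<close>)
  also have "\<dots> = (\<integral>w. ?b w * indicator (?A \<inter> ?C) w \<partial>M)"
    by (rule F.real_cond_exp_intg(2)) (use int2 b_F in auto)
  finally have real_eq: "(\<integral>w. (?b w * r w) * indicator ?A w \<partial>M) =
      (\<integral>w. ?b w * indicator (?A \<inter> ?C) w \<partial>M)" .
  have "(\<integral>\<^sup>+w. k (T w) * indicator A (Y w) * indicator B (T w) \<partial>M) =
      (\<integral>\<^sup>+w. ennreal ((?b w * r w) * indicator ?A w) \<partial>M)"
    by (rule nn_integral_cong_AE, use r_eq AE_space in eventually_elim) (auto simp: indicator_def)
  also have "\<dots> = ennreal (\<integral>w. (?b w * r w) * indicator ?A w \<partial>M)"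
    by (rule nn_integral_eq_integral[OF int1]) (auto simp: r_def)
  also have "\<dots> = (\<integral>\<^sup>+w. ennreal (?b w * indicator (?A \<inter> ?C) w) \<partial>M)"
    unfolding real_eq by (rule nn_integral_eq_integral[OF int2, symmetric]) auto
  also have "\<dots> = (\<integral>\<^sup>+w. indicator {w\<in>space M. Y w \<in> A \<and> T w \<in> B \<and> Z w \<in> C} w \<partial>M)"
    by (intro nn_integral_cong) (auto simp: indicator_def)
  finally show ?thesis by simp
qed

text \<open>Integrating \<open>g (t, z)\<close> over \<open>z\<close> in \<open>C\<close> gives a
  version of the conditional probability of \<open>Z\<close> in \<open>C\<close> given
  \<open>T = t\<close>. Along the chain, knowing \<open>Y\<close> as well does not change it, so
  adjoining \<open>Y\<close> to \<open>T\<close> leaves the density with respect to the product of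
  the marginals unchanged.\<close>

lemma (in prob_space) markov_chain_density:
  assumes Y[measurable]: "Y \<in> M \<rightarrow>\<^sub>M K" and T[measurable]: "T \<in> M \<rightarrow>\<^sub>M L" and Z[measurable]: "Z \<in> M \<rightarrow>\<^sub>M N"
    and markov: "markov_chain M K L N Y T Z"
    and g[measurable]: "g \<in> borel_measurable (L \<Otimes>\<^sub>M N)"
    and dens: "distr M (L \<Otimes>\<^sub>M N) (\<lambda>w. (T w, Z w)) = density (distr M L T \<Otimes>\<^sub>M distr M N Z) g"
  shows "distr M ((K \<Otimes>\<^sub>M L) \<Otimes>\<^sub>M N) (\<lambda>w. ((Y w, T w), Z w)) =
    density (distr M (K \<Otimes>\<^sub>M L) (\<lambda>w. (Y w, T w)) \<Otimes>\<^sub>M distr M N Z) (\<lambda>(x, z). g (snd x, z))"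
    (is "?P = ?Q")
proof (rule finite_measure_pair_eqI)
  interpret PZ: prob_space "distr M N Z" by (rule prob_space_distr) fact
  show "finite_measure ?P"
    by (intro prob_space.finite_measure prob_space_distr) measurable
  fix E C assume E[measurable]: "E \<in> sets (K \<Otimes>\<^sub>M L)" and C[measurable]: "C \<in> sets N"
  define k where "k t = (\<integral>\<^sup>+z. g (t, z) * indicator C z \<partial>distr M N Z)" for t
  have k[measurable]: "k \<in> borel_measurable L"
    unfolding k_def by measurable
  have k_eq: "(\<integral>\<^sup>+w. k (T w) * indicator B (T w) \<partial>M) = emeasure M {w\<in>space M. T w \<in> B \<and> Z w \<in> C}"
    if [measurable]: "B \<in> sets L" for B
  proof -
    have "emeasure M {w\<in>space M. T w \<in> B \<and> Z w \<in> C} =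
        emeasure (distr M (L \<Otimes>\<^sub>M N) (\<lambda>w. (T w, Z w))) (B \<times> C)"
      by (subst emeasure_distr) (auto intro!: arg_cong[where f="emeasure M"])
    also have "\<dots> = (\<integral>\<^sup>+x. g x * indicator (B \<times> C) x \<partial>(distr M L T \<Otimes>\<^sub>M distr M N Z))"
      unfolding dens by (subst emeasure_density) auto
    also have "\<dots> = (\<integral>\<^sup>+t. \<integral>\<^sup>+z. g (t, z) * indicator (B \<times> C) (t, z) \<partial>distr M N Z \<partial>distr M L T)"
      by (subst PZ.nn_integral_fst[symmetric]) auto
    also have "\<dots> = (\<integral>\<^sup>+t. k t * indicator B t \<partial>distr M L T)"
      unfolding k_def by (intro nn_integral_cong) (auto simp: indicator_def)
    finally show ?thesis
      by (simp add: nn_integral_distr)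
  qed
  \<comment> \<open>The event \<open>E\<close> need not be a rectangle in \<open>Y\<close> and
    \<open>T\<close>, whereas the conditional identity is known for rectangles. For fixed
    \<open>C\<close> it is therefore read as an equality of two finite measures on the space of
    pairs: \<open>S\<close> is the law of \<open>(Y, T)\<close> restricted to the event that
    \<open>Z\<close> lies in \<open>C\<close>, and \<open>R\<close> has density \<open>k\<close>
    with respect to the law of \<open>(Y, T)\<close>.\<close>
  define R where "R = density (distr M (K \<Otimes>\<^sub>M L) (\<lambda>w. (Y w, T w))) (\<lambda>(y, t). k t)"
  define S where "S = distr (density M (indicator (Z -` C \<inter> space M))) (K \<Otimes>\<^sub>M L) (\<lambda>w. (Y w, T w))"
  have S_eq: "emeasure S D = emeasure M {w\<in>space M. (Y w, T w) \<in> D \<and> Z w \<in> C}"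
    if [measurable]: "D \<in> sets (K \<Otimes>\<^sub>M L)" for D
  proof -
    have "emeasure S D = emeasure (density M (indicator (Z -` C \<inter> space M)))
        ((\<lambda>w. (Y w, T w)) -` D \<inter> space M)"
      unfolding S_def by (subst emeasure_distr) auto
    also have "\<dots> = (\<integral>\<^sup>+w. indicator (Z -` C \<inter> space M) w *
        indicator ((\<lambda>w. (Y w, T w)) -` D \<inter> space M) w \<partial>M)"
      by (subst emeasure_density) auto
    also have "\<dots> = (\<integral>\<^sup>+w. indicator {w\<in>space M. (Y w, T w) \<in> D \<and> Z w \<in> C} w \<partial>M)"
      by (intro nn_integral_cong) (auto simp: indicator_def)
    finally show ?thesis by simp
  qed
  have "S = R"
  proof (rule finite_measure_pair_eqI)
    show "finite_measure S"
      unfolding S_def by (intro finite_measure.finite_measure_distr finite_measureI)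
        (auto simp: emeasure_density nn_integral_indicator emeasure_eq_measure)
    fix A B assume [measurable]: "A \<in> sets K" "B \<in> sets L"
    have "emeasure S (A \<times> B) = emeasure M {w\<in>space M. Y w \<in> A \<and> T w \<in> B \<and> Z w \<in> C}"
      by (subst S_eq) (auto intro!: arg_cong[where f="emeasure M"])
    also have "\<dots> = (\<integral>\<^sup>+w. k (T w) * indicator A (Y w) * indicator B (T w) \<partial>M)"
      by (rule markov_chain_cond_integral[OF Y T Z markov k k_eq, symmetric]) auto
    also have "\<dots> = emeasure R (A \<times> B)"
      unfolding R_def by (subst emeasure_density, simp, simp, subst nn_integral_distr)
        (auto intro!: nn_integral_cong simp: indicator_def)
    finally show "emeasure S (A \<times> B) = emeasure R (A \<times> B)" .
  qed (auto simp: R_def S_def)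
  have "emeasure ?P (E \<times> C) = emeasure M {w\<in>space M. (Y w, T w) \<in> E \<and> Z w \<in> C}"
    by (subst emeasure_distr) (auto intro!: arg_cong[where f="emeasure M"])
  also have "\<dots> = emeasure S E"
    by (simp add: S_eq)
  also have "\<dots> = (\<integral>\<^sup>+x. k (snd x) * indicator E x \<partial>distr M (K \<Otimes>\<^sub>M L) (\<lambda>w. (Y w, T w)))"
    unfolding \<open>S = R\<close> R_def by (subst emeasure_density) (auto simp: case_prod_beta')
  also have "\<dots> = (\<integral>\<^sup>+x. \<integral>\<^sup>+z. g (snd x, z) * indicator (E \<times> C) (x, z) \<partial>distr M N Z
      \<partial>distr M (K \<Otimes>\<^sub>M L) (\<lambda>w. (Y w, T w)))"
    unfolding k_def by (intro nn_integral_cong) (auto simp: indicator_def)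
  also have "\<dots> = (\<integral>\<^sup>+x. g (snd (fst x), snd x) * indicator (E \<times> C) x
      \<partial>(distr M (K \<Otimes>\<^sub>M L) (\<lambda>w. (Y w, T w)) \<Otimes>\<^sub>M distr M N Z))"
    by (subst PZ.nn_integral_fst[symmetric]) auto
  also have "\<dots> = emeasure ?Q (E \<times> C)"
    by (subst emeasure_density) (auto simp: case_prod_beta')
  finally show "emeasure ?P (E \<times> C) = emeasure ?Q (E \<times> C)" .
qed (auto intro!: sets_pair_measure_cong)

section \<open>Mutual information as an expected log-density, and data processing\<close>

text \<open>Replaces Radon-Nikodym derivatives and divergence integrals by one real density
  \<open>g\<close> and the random variable \<open>ln (g (Y w, Z w))\<close> on \<open>M\<close>, so
  that the densities of different pairs can be compared pointwise.\<close>

lemma (in prob_space) mutual_info_densityE: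
  assumes Y[measurable]: "Y \<in> M \<rightarrow>\<^sub>M K" and Z[measurable]: "Z \<in> M \<rightarrow>\<^sub>M N"
    and ac: "absolutely_continuous (distr M K Y \<Otimes>\<^sub>M distr M N Z) (distr M (K \<Otimes>\<^sub>M N) (\<lambda>w. (Y w, Z w)))"
  obtains g :: "_ \<Rightarrow> real" where "g \<in> borel_measurable (K \<Otimes>\<^sub>M N)" "\<And>x. 0 \<le> g x"
    "distr M (K \<Otimes>\<^sub>M N) (\<lambda>w. (Y w, Z w)) = density (distr M K Y \<Otimes>\<^sub>M distr M N Z) g"
    "AE w in M. 0 < g (Y w, Z w)"
    "mutual_info M K N Y Z = (if integrable M (\<lambda>w. ln (g (Y w, Z w)))
       then ennreal ((\<integral>w. ln (g (Y w, Z w)) \<partial>M) / ln 2) else \<infinity>)"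
proof
  let ?Q = "distr M K Y \<Otimes>\<^sub>M distr M N Z" and ?P = "distr M (K \<Otimes>\<^sub>M N) (\<lambda>w. (Y w, Z w))"
  interpret PY: prob_space "distr M K Y" by (rule prob_space_distr) fact
  interpret PZ: prob_space "distr M N Z" by (rule prob_space_distr) fact
  interpret Q: pair_prob_space "distr M K Y" "distr M N Z" ..
  interpret P: prob_space ?P by (rule prob_space_distr) measurable
  have sets_Q[measurable_cong]: "sets ?Q = sets (K \<Otimes>\<^sub>M N)"
    by (intro sets_pair_measure_cong) auto
  \<comment> \<open>\<open>enn2real\<close> sends infinity to 0. This changes the derivative on a
    null set only, since the joint law is sigma-finite.\<close>
  define g where "g x = enn2real (RN_deriv ?Q ?P x)" for x
  have "RN_deriv ?Q ?P \<in> borel_measurable ?Q" by simp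
  then have [measurable]: "RN_deriv ?Q ?P \<in> borel_measurable (K \<Otimes>\<^sub>M N)"
    by (simp cong: measurable_cong_sets)
  show g[measurable]: "g \<in> borel_measurable (K \<Otimes>\<^sub>M N)"
    unfolding g_def by measurable
  show "0 \<le> g x" for x
    by (simp add: g_def)
  have "AE x in ?Q. RN_deriv ?Q ?P x \<noteq> \<infinity>"
    by (rule Q.RN_deriv_finite) (auto intro: ac P.sigma_finite_measure_axioms simp: sets_Q)
  then have "AE x in ?Q. RN_deriv ?Q ?P x = ennreal (g x)"
    by eventually_elim (simp add: g_def less_top)
  then have "density ?Q (RN_deriv ?Q ?P) = density ?Q g"
    by (intro density_cong) auto
  then show dens: "?P = density ?Q g"
    using Q.density_RN_deriv[OF ac] sets_Q by simp
  \<comment> \<open>The zero set of a density is null for the measure having that density.\<close>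
  have "AE x in density ?Q g. 0 < g x"
    by (subst AE_density) auto
  then have "AE x in ?P. 0 < g x"
    unfolding dens .
  then show "AE w in M. 0 < g (Y w, Z w)"
    by (subst (asm) AE_distr_iff) auto
  \<comment> \<open>An identity everywhere and not just almost everywhere, since
    \<open>entropy_density\<close> itself applies \<open>enn2real\<close> to the derivative.\<close>
  have ent: "entropy_density 2 ?Q ?P = (\<lambda>x. ln (g x) / ln 2)"
    by (auto simp: entropy_density_def g_def log_def)
  have "integrable ?P (entropy_density 2 ?Q ?P) \<longleftrightarrow> integrable M (\<lambda>w. ln (g (Y w, Z w)))"
    unfolding ent by (subst integrable_distr_eq) (auto simp: divide_inverse)
  moreover have "mutual_information 2 K N Y Z = (\<integral>w. ln (g (Y w, Z w)) \<partial>M) / ln 2"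
    unfolding mutual_information_def KL_divergence_def ent by (subst integral_distr) auto
  ultimately show "mutual_info M K N Y Z = (if integrable M (\<lambda>w. ln (g (Y w, Z w)))
       then ennreal ((\<integral>w. ln (g (Y w, Z w)) \<partial>M) / ln 2) else \<infinity>)"
    using ac by (simp add: mutual_info_def Let_def)
qed

text \<open>The factor \<open>g x * (1 / g x)\<close> is 1 where \<open>g\<close> is positive and 0
  where \<open>g\<close> vanishes, by the convention \<open>1 / 0 = 0\<close>. Equality can fail
  because the mass of \<open>f\<close> on the zero set of \<open>g\<close> is lost.\<close>

lemma nn_integral_density_inverse_le:
  fixes g :: "'x \<Rightarrow> real"
  assumes [measurable]: "g \<in> borel_measurable Q" "f \<in> borel_measurable Q" and "\<And>x. 0 \<le> g x"
  shows "(\<integral>\<^sup>+x. f x * ennreal (1 / g x) \<partial>density Q g) \<le> (\<integral>\<^sup>+x. f x \<partial>Q)"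
proof -
  have "(\<integral>\<^sup>+x. f x * ennreal (1 / g x) \<partial>density Q g) = (\<integral>\<^sup>+x. ennreal (g x) * (f x * ennreal (1 / g x)) \<partial>Q)"
    by (subst nn_integral_density) auto
  also have "\<dots> = (\<integral>\<^sup>+x. f x * ennreal (g x * (1 / g x)) \<partial>Q)"
    using assms(3) by (intro nn_integral_cong) (simp only: ennreal_mult zero_le_divide_1_iff ac_simps)
  also have "\<dots> \<le> (\<integral>\<^sup>+x. f x * 1 \<partial>Q)"
    by (intro nn_integral_mono mult_left_mono) auto
  finally show ?thesis by simp
qed

text \<open>Forgetting \<open>T\<close> carries the reference measure for \<open>((Y, T), Z)\<close>
  to the one for \<open>(Y, Z)\<close>, because the map acts on the first factor alone.\<close>

lemma (in prob_space) distr_pair_drop: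
  assumes Y[measurable]: "Y \<in> M \<rightarrow>\<^sub>M K" and T[measurable]: "T \<in> M \<rightarrow>\<^sub>M L" and Z[measurable]: "Z \<in> M \<rightarrow>\<^sub>M N"
  shows "distr (distr M (K \<Otimes>\<^sub>M L) (\<lambda>w. (Y w, T w)) \<Otimes>\<^sub>M distr M N Z) (K \<Otimes>\<^sub>M N) (\<lambda>(x, z). (fst x, z)) =
    distr M K Y \<Otimes>\<^sub>M distr M N Z"
proof -
  interpret PZ: prob_space "distr M N Z" by (rule prob_space_distr) fact
  let ?P = "distr M (K \<Otimes>\<^sub>M L) (\<lambda>w. (Y w, T w))"
  have "distr ?P K fst \<Otimes>\<^sub>M distr (distr M N Z) N (\<lambda>z. z) =
      distr (?P \<Otimes>\<^sub>M distr M N Z) (K \<Otimes>\<^sub>M N) (\<lambda>(x, z). (fst x, z))"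
    by (rule pair_measure_distr) (auto simp: PZ.sigma_finite_measure_axioms distr_id2)
  moreover have "distr ?P K fst = distr M K Y"
    by (subst distr_distr) (auto simp: comp_def)
  ultimately show ?thesis
    by (simp add: distr_id2 case_prod_beta')
qed

text \<open>Absolute continuity is inherited by images under a common map. Here the map forgets
  \<open>T\<close>: it sends the joint law of \<open>((Y, T), Z)\<close> to that of
  \<open>(Y, Z)\<close>, and likewise the reference measures.\<close>

lemma (in prob_space) markov_chain_absolutely_continuous:
  assumes Y[measurable]: "Y \<in> M \<rightarrow>\<^sub>M K" and T[measurable]: "T \<in> M \<rightarrow>\<^sub>M L" and Z[measurable]: "Z \<in> M \<rightarrow>\<^sub>M N"
    and P3: "distr M ((K \<Otimes>\<^sub>M L) \<Otimes>\<^sub>M N) (\<lambda>w. ((Y w, T w), Z w)) =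
      density (distr M (K \<Otimes>\<^sub>M L) (\<lambda>w. (Y w, T w)) \<Otimes>\<^sub>M distr M N Z) g"
    and g[measurable]: "g \<in> borel_measurable ((K \<Otimes>\<^sub>M L) \<Otimes>\<^sub>M N)"
  shows "absolutely_continuous (distr M K Y \<Otimes>\<^sub>M distr M N Z) (distr M (K \<Otimes>\<^sub>M N) (\<lambda>w. (Y w, Z w)))"
  unfolding absolutely_continuous_def
proof (rule subsetI)
  let ?Q3 = "distr M (K \<Otimes>\<^sub>M L) (\<lambda>w. (Y w, T w)) \<Otimes>\<^sub>M distr M N Z"
    and ?P3 = "distr M ((K \<Otimes>\<^sub>M L) \<Otimes>\<^sub>M N) (\<lambda>w. ((Y w, T w), Z w))"
    and ?p = "\<lambda>(x, z). (fst x, z)"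
  have sets_Q3[measurable_cong]: "sets ?Q3 = sets ((K \<Otimes>\<^sub>M L) \<Otimes>\<^sub>M N)"
    by (intro sets_pair_measure_cong) auto
  have P_eq: "distr M (K \<Otimes>\<^sub>M N) (\<lambda>w. (Y w, Z w)) = distr ?P3 (K \<Otimes>\<^sub>M N) ?p"
    by (subst distr_distr) (auto simp: comp_def)
  have "absolutely_continuous ?Q3 ?P3"
    unfolding P3 by (rule absolutely_continuousI_density) measurable
  fix D assume "D \<in> null_sets (distr M K Y \<Otimes>\<^sub>M distr M N Z)"
  then have D: "D \<in> null_sets (distr ?Q3 (K \<Otimes>\<^sub>M N) ?p)"
    by (simp only: distr_pair_drop[OF Y T Z])
  then have "D \<in> sets (K \<Otimes>\<^sub>M N)" "?p -` D \<inter> space ?Q3 \<in> null_sets ?Q3"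
    by (subst (asm) null_sets_distr_iff; auto)+
  moreover then have "?p -` D \<inter> space ?P3 \<in> null_sets ?P3"
    using \<open>absolutely_continuous ?Q3 ?P3\<close> by (auto simp: absolutely_continuous_def space_pair_measure)
  ultimately show "D \<in> null_sets (distr M (K \<Otimes>\<^sub>M N) (\<lambda>w. (Y w, Z w)))"
    unfolding P_eq by (subst null_sets_distr_iff) auto
qed

text \<open>Elementary proof of the data processing inequality: with \<open>g\<close>, \<open>h\<close> the densities of \<open>(T, Z)\<close> and
  \<open>(Y, Z)\<close>, take expectations in \<open>ln h \<le> ln g + h / g - 1\<close>, where \<open>h / g\<close> has expectation at most 1
  because \<open>g\<close> is also the density of \<open>((Y, T), Z)\<close>. Integrability of
  \<open>ln h\<close> follows from this bound and \<open>- 1 / h \<le> ln h\<close>.\<close>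

theorem (in prob_space) mutual_info_data_processing:
  assumes Y[measurable]: "Y \<in> M \<rightarrow>\<^sub>M K" and T[measurable]: "T \<in> M \<rightarrow>\<^sub>M L" and Z[measurable]: "Z \<in> M \<rightarrow>\<^sub>M N"
    and markov: "markov_chain M K L N Y T Z"
  shows "mutual_info M K N Y Z \<le> mutual_info M L N T Z"
\<comment> \<open>If absolute continuity fails for \<open>(T, Z)\<close>, or \<open>ln g\<close> is
  not integrable, the right-hand side is infinite and the claim is trivial.\<close>
proof (cases "absolutely_continuous (distr M L T \<Otimes>\<^sub>M distr M N Z) (distr M (L \<Otimes>\<^sub>M N) (\<lambda>w. (T w, Z w)))")
  case True
  obtain g :: "_ \<Rightarrow> real" where g[measurable]: "g \<in> borel_measurable (L \<Otimes>\<^sub>M N)" and g0: "\<And>x. 0 \<le> g x"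
    and g_dens: "distr M (L \<Otimes>\<^sub>M N) (\<lambda>w. (T w, Z w)) = density (distr M L T \<Otimes>\<^sub>M distr M N Z) g"
    and g_pos: "AE w in M. 0 < g (T w, Z w)"
    and g_info: "mutual_info M L N T Z = (if integrable M (\<lambda>w. ln (g (T w, Z w)))
       then ennreal ((\<integral>w. ln (g (T w, Z w)) \<partial>M) / ln 2) else \<infinity>)"
    by (rule mutual_info_densityE[OF T Z True]) (rule that)
  show ?thesis
  proof (cases "integrable M (\<lambda>w. ln (g (T w, Z w)))")
    case g_int: True
    let ?Q = "distr M (K \<Otimes>\<^sub>M L) (\<lambda>w. (Y w, T w)) \<Otimes>\<^sub>M distr M N Z"
    have g3[measurable]: "(\<lambda>(x, z). g (snd x, z)) \<in> borel_measurable ((K \<Otimes>\<^sub>M L) \<Otimes>\<^sub>M N)"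
      by measurable
    have P3: "distr M ((K \<Otimes>\<^sub>M L) \<Otimes>\<^sub>M N) (\<lambda>w. ((Y w, T w), Z w)) =
        density ?Q (\<lambda>x. ennreal (case x of (x, z) \<Rightarrow> g (snd x, z)))"
      using markov_chain_density[OF Y T Z markov _ g_dens] by (simp add: case_prod_beta')
    have ac: "absolutely_continuous (distr M K Y \<Otimes>\<^sub>M distr M N Z) (distr M (K \<Otimes>\<^sub>M N) (\<lambda>w. (Y w, Z w)))"
      by (rule markov_chain_absolutely_continuous[OF Y T Z P3]) measurable
    obtain h :: "_ \<Rightarrow> real" where h[measurable]: "h \<in> borel_measurable (K \<Otimes>\<^sub>M N)" and h0: "\<And>x. 0 \<le> h x"
      and h_dens: "distr M (K \<Otimes>\<^sub>M N) (\<lambda>w. (Y w, Z w)) = density (distr M K Y \<Otimes>\<^sub>M distr M N Z) h"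
      and h_pos: "AE w in M. 0 < h (Y w, Z w)"
      and h_info: "mutual_info M K N Y Z = (if integrable M (\<lambda>w. ln (h (Y w, Z w)))
         then ennreal ((\<integral>w. ln (h (Y w, Z w)) \<partial>M) / ln 2) else \<infinity>)"
      by (rule mutual_info_densityE[OF Y Z ac]) (rule that)
    interpret PY: prob_space "distr M K Y" by (rule prob_space_distr) fact
    interpret PZ: prob_space "distr M N Z" by (rule prob_space_distr) fact
    interpret PYZ: pair_prob_space "distr M K Y" "distr M N Z" ..
    define G where "G w = g (T w, Z w)" for w
    define H where "H w = h (Y w, Z w)" for w
    have GH[measurable]: "G \<in> borel_measurable M" "H \<in> borel_measurable M"
      unfolding G_def H_def by measurable
    have pos: "AE w in M. 0 < G w \<and> 0 < H w"
      using g_pos h_pos by (auto simp: G_def H_def)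
    \<comment> \<open>Integrating \<open>1 / h\<close> against the law with density \<open>h\<close>
      cancels \<open>h\<close> and leaves at most the mass of a product of probability
      measures.\<close>
    have inv_le: "(\<integral>\<^sup>+w. ennreal (1 / H w) \<partial>M) \<le> 1"
    proof -
      have "(\<integral>\<^sup>+w. ennreal (1 / H w) \<partial>M) = (\<integral>\<^sup>+x. 1 * ennreal (1 / h x) \<partial>distr M (K \<Otimes>\<^sub>M N) (\<lambda>w. (Y w, Z w)))"
        by (subst nn_integral_distr) (auto simp: H_def)
      also have "\<dots> \<le> (\<integral>\<^sup>+x. 1 \<partial>(distr M K Y \<Otimes>\<^sub>M distr M N Z))"
        unfolding h_dens by (rule nn_integral_density_inverse_le) (auto simp: h0)
      also have "\<dots> = 1" by (simp add: PYZ.emeasure_space_1)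
      finally show ?thesis .
    qed
    \<comment> \<open>Under the law of \<open>((Y, T), Z)\<close>, dividing by \<open>g\<close>
      cancels its density and leaves the integral of \<open>h\<close> over \<open>?Q\<close>. As
      \<open>h\<close> does not see \<open>T\<close>, this is an integral over the product of the
      laws of \<open>Y\<close> and \<open>Z\<close>, and equals the total mass 1 of the law of
      \<open>(Y, Z)\<close>.\<close>
    have ratio_le: "(\<integral>\<^sup>+w. ennreal (H w / G w) \<partial>M) \<le> 1"
    proof -
      have "(\<integral>\<^sup>+w. ennreal (H w / G w) \<partial>M) =
          (\<integral>\<^sup>+x. (case x of (x, z) \<Rightarrow> ennreal (h (fst x, z))) * ennreal (1 / (case x of (x, z) \<Rightarrow> g (snd x, z)))
            \<partial>distr M ((K \<Otimes>\<^sub>M L) \<Otimes>\<^sub>M N) (\<lambda>w. ((Y w, T w), Z w)))"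
        by (subst nn_integral_distr) (auto simp: H_def G_def h0 g0 ennreal_mult[symmetric])
      also have "\<dots> \<le> (\<integral>\<^sup>+x. (case x of (x, z) \<Rightarrow> ennreal (h (fst x, z))) \<partial>?Q)"
        unfolding P3 by (rule nn_integral_density_inverse_le) (auto simp: g0)
      also have "\<dots> = (\<integral>\<^sup>+x. ennreal (h x) \<partial>distr ?Q (K \<Otimes>\<^sub>M N) (\<lambda>(x, z). (fst x, z)))"
        by (subst nn_integral_distr) (auto intro!: nn_integral_cong)
      also have "\<dots> = (\<integral>\<^sup>+x. ennreal (h x) \<partial>(distr M K Y \<Otimes>\<^sub>M distr M N Z))"
        by (simp only: distr_pair_drop[OF Y T Z])
      also have "\<dots> = emeasure (density (distr M K Y \<Otimes>\<^sub>M distr M N Z) h) (space (K \<Otimes>\<^sub>M N))"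
        by (subst emeasure_density) (auto intro!: nn_integral_cong simp: space_pair_measure)
      also have "\<dots> = 1"
        unfolding h_dens[symmetric] by (subst emeasure_distr) (auto simp: space_pair_measure emeasure_space_1
          Y[THEN measurable_space] Z[THEN measurable_space] intro!: trans[OF arg_cong[where f="emeasure M"] emeasure_space_1])
      finally show ?thesis .
    qed
    have inv_int: "integrable M (\<lambda>w. 1 / H w)"
      by (rule integrableI_nonneg) (use inv_le h0 in \<open>auto simp: H_def intro: le_less_trans\<close>)
    have ratio_int: "integrable M (\<lambda>w. H w / G w)"
      by (rule integrableI_nonneg) (use ratio_le h0 g0 in \<open>auto simp: H_def G_def intro: le_less_trans\<close>)
    have ratio_E: "(\<integral>w. H w / G w \<partial>M) \<le> 1"
      using ratio_le nn_integral_eq_integral[OF ratio_int] h0 g0 by (auto simp: H_def G_def)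
    have G_int: "integrable M (\<lambda>w. ln (G w))"
      using g_int by (simp add: G_def)
    have upper: "AE w in M. ln (H w) \<le> ln (G w) + H w / G w - 1"
      using pos
    proof eventually_elim
      case (elim w)
      then have "ln (H w / G w) \<le> H w / G w - 1"
        by (intro ln_le_minus_one) auto
      with elim show ?case by (simp add: ln_div)
    qed
    have lower: "AE w in M. - (1 / H w) \<le> ln (H w)"
      using pos
    proof eventually_elim
      case (elim w)
      then have "ln (1 / H w) \<le> 1 / H w - 1"
        by (intro ln_le_minus_one) auto
      with elim show ?case by (simp add: ln_div)
    qed
    \<comment> \<open>\<open>upper\<close> bounds \<open>ln H\<close> from above and
      \<open>lower\<close> from below; the dominating function adds up the absolute terms of both
      bounds.\<close>
    have H_int: "integrable M (\<lambda>w. ln (H w))"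
    proof (rule Bochner_Integration.integrable_bound)
      show "integrable M (\<lambda>w. 1 / H w + \<bar>ln (G w)\<bar> + H w / G w)"
        using inv_int G_int ratio_int by auto
      show "AE w in M. norm (ln (H w)) \<le> norm (1 / H w + \<bar>ln (G w)\<bar> + H w / G w)"
        using pos upper lower
      proof eventually_elim
        case (elim w)
        then have "0 < 1 / H w" "0 < H w / G w" by auto
        with elim show ?case unfolding real_norm_def by linarith
      qed
    qed measurable
    have "(\<integral>w. ln (H w) \<partial>M) \<le> (\<integral>w. ln (G w) + H w / G w - 1 \<partial>M)"
      using H_int G_int ratio_int upper by (intro integral_mono_AE) auto
    also have "\<dots> = (\<integral>w. ln (G w) \<partial>M) + (\<integral>w. H w / G w \<partial>M) - 1"
      using G_int ratio_int by (simp add: prob_space)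
    also have "\<dots> \<le> (\<integral>w. ln (G w) \<partial>M)"
      using ratio_E by simp
    finally show ?thesis
      using H_int G_int unfolding g_info h_info G_def H_def by (auto intro!: ennreal_leI divide_right_mono)
  qed (simp add: g_info)
qed (simp add: mutual_info_def Let_def)

section \<open>The extension by noise and the auxiliary variables on it\<close>

lemma prob_space_noise: "prob_space noise"
  unfolding noise_def by (intro prob_space_PiM prob_space_uniform_measure) auto

lemma prob_space_ext_space: "prob_space M \<Longrightarrow> prob_space (ext_space M)"
  unfolding ext_space_def using prob_space_noise by (intro prob_space_pair)

lemma measurable_lift_rv[measurable]:
  assumes [measurable]: "Y \<in> M \<rightarrow>\<^sub>M K"
  shows "lift_rv Y \<in> ext_space M \<rightarrow>\<^sub>M K"
  unfolding lift_rv_def ext_space_def by measurable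

lemma distr_ext_space:
  assumes [measurable]: "Y \<in> M \<rightarrow>\<^sub>M K"
  shows "distr (ext_space M) K (lift_rv Y) = distr M K Y"
proof -
  have "distr (ext_space M) K (lift_rv Y) = distr (distr (ext_space M) M fst) K Y"
    by (subst distr_distr) (auto simp: ext_space_def lift_rv_def comp_def case_prod_beta')
  also have "distr (ext_space M) M fst = M"
    unfolding ext_space_def by (rule prob_space.distr_pair_fst[OF prob_space_noise])
  finally show ?thesis .
qed

text \<open>Lifting ignores the noise coordinate, whose total mass is 1, so laws and joint laws are
  unchanged. This takes the information of the initial auxiliary back to \<open>M\<close>.\<close>

lemma mutual_info_lift_rv:
  assumes "prob_space M" and Y[measurable]: "Y \<in> M \<rightarrow>\<^sub>M K" and Z[measurable]: "Z \<in> M \<rightarrow>\<^sub>M N"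
  shows "mutual_info (ext_space M) K N (lift_rv Y) (lift_rv Z) = mutual_info M K N Y Z"
proof -
  have "(\<lambda>w. (lift_rv Y w, lift_rv Z w)) = lift_rv (\<lambda>w. (Y w, Z w))"
    by (auto simp: lift_rv_def)
  moreover have "(\<lambda>w. (Y w, Z w)) \<in> M \<rightarrow>\<^sub>M K \<Otimes>\<^sub>M N" by measurable
  ultimately show ?thesis
    using assms by (simp add: mutual_info_def distr_ext_space prob_space_ext_space
        prob_space.mutual_information_def Let_def)
qed

text \<open>An event about one component is a cylinder event about the joint vector. For indices in
  \<open>{1..n}\<close> the restricted function \<open>joint_rv\<close> does carry the true
  component.\<close>

lemma markov_chain_component:
  fixes X :: "nat \<Rightarrow> 'a \<Rightarrow> 'b::topological_space"
  assumes "markov_chain (ext_space M) K L (joint_space n) S T (joint_rv n X)" and j: "j \<in> {1..n}"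
  shows "markov_chain (ext_space M) K L borel S T (lift_rv (X j))"
  unfolding markov_chain_def
proof (intro ballI)
  fix A B assume A: "A \<in> sets K" and B: "B \<in> sets (borel :: 'b measure)"
  let ?B = "(\<lambda>x. x j) -` B \<inter> space (joint_space n) :: (nat \<Rightarrow> 'b) set"
  have B': "?B \<in> sets (joint_space n)"
    using B j unfolding joint_space_def by measurable
  have "lift_rv (X j) -` B \<inter> space (ext_space M) = joint_rv n X -` ?B \<inter> space (ext_space M)"
    using j by (auto simp: joint_rv_def joint_space_def space_PiM)
  with assms(1)[unfolded markov_chain_def, rule_format, OF A B'] show "AE w in ext_space M. cond_prob_given (ext_space M) L T
      ((S -` A \<inter> space (ext_space M)) \<inter> (lift_rv (X j) -` B \<inter> space (ext_space M))) w =
      cond_prob_given (ext_space M) L T (S -` A \<inter> space (ext_space M)) w *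
      cond_prob_given (ext_space M) L T (lift_rv (X j) -` B \<inter> space (ext_space M)) w"
    by simp
qed

lemma stoch_fun_measurable:
  assumes "stoch_fun M n X l T S" and [measurable]: "T \<in> borel_measurable (ext_space M)"
  shows "S \<in> borel_measurable (ext_space M)"
proof -
  obtain f h where [measurable]: "f \<in> borel_measurable (borel \<Otimes>\<^sub>M (borel :: real measure))"
    "h \<in> borel_measurable (M \<Otimes>\<^sub>M PiM {1..l} (\<lambda>_. borel :: real measure))"
    and S: "S = (\<lambda>w. f (T w, (\<lambda>(w, u). h (w, restrict u {1..l})) w))"
    using assms(1) unfolding stoch_fun_def by blast
  \<comment> \<open>The factors of \<open>noise\<close> are uniform measures, while \<open>h\<close>
    is measurable for products of \<open>borel\<close>; both have the same measurable sets.\<close>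
  have "sets noise = sets (PiM UNIV (\<lambda>_. borel :: real measure))"
    unfolding noise_def by (intro sets_PiM_cong) auto
  then have [measurable_cong]: "sets (ext_space M) = sets (M \<Otimes>\<^sub>M PiM UNIV (\<lambda>_. borel :: real measure))"
    unfolding ext_space_def by (intro sets_pair_measure_cong) auto
  have "(\<lambda>u. restrict u {1..l}) \<in> PiM UNIV (\<lambda>_. borel :: real measure) \<rightarrow>\<^sub>M PiM {1..l} (\<lambda>_. borel)"
    by (rule measurable_restrict_subset) auto
  then have [measurable]: "(\<lambda>(w, u). h (w, restrict u {1..l})) \<in> borel_measurable (ext_space M)"
    by measurable
  show ?thesis unfolding S by measurable
qed

section \<open>Bounding the higher-order common information\<close>

text \<open>Valid for every ordering: the Markov chain of each stage involves the whole joint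
  vector, so it yields one with \<open>X j\<close> whichever variable \<open>\<pi> l\<close> selects
  at that stage.\<close>

lemma mutual_info_terminal_le:
  assumes "prob_space M" and n: "n \<ge> 2" and X: "\<And>k. k \<in> {1..n} \<Longrightarrow> X k \<in> borel_measurable M"
    and i: "i \<in> {1..n}" and j: "j \<in> {1..n}" and "S \<in> terminal_aux M n X i"
  shows "mutual_info (ext_space M) borel borel S (lift_rv (X j)) \<le> mutual_info M borel borel (X i) (X j)"
proof -
  interpret E: prob_space "ext_space M" by (rule prob_space_ext_space) fact
  from \<open>S \<in> _\<close> obtain \<pi> T where S: "S = T (n - 1)" and T1: "T 1 = lift_rv (X i)"
    and step: "\<And>l. l \<in> {1..n-2} \<Longrightarrow> T (l + 1) \<in> minimizers M n X l \<pi> (T l)"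
    unfolding terminal_aux_def terminal_aux_ord_def by blast
  \<comment> \<open>Stages are counted from 1, hence the shift by \<open>Suc\<close>. Measurability
    is carried through the induction because data processing requires it of both
    auxiliaries.\<close>
  have "T (Suc m) \<in> borel_measurable (ext_space M) \<and>
      mutual_info (ext_space M) borel borel (T (Suc m)) (lift_rv (X j)) \<le> mutual_info M borel borel (X i) (X j)"
    if "m \<le> n - 2" for m
    using that
  proof (induction m)
    case 0
    then show ?case
      using T1 X[OF i] X[OF j] mutual_info_lift_rv[OF assms(1) X[OF i] X[OF j]]
      by (simp add: measurable_lift_rv)
  next
    case (Suc m)
    then have feas: "feasible M n X (Suc m) \<pi> (T (Suc m)) (T (Suc (Suc m)))"
      using step[of "Suc m"] by (simp add: minimizers_def is_arg_min_def)
    have meas: "T (Suc (Suc m)) \<in> borel_measurable (ext_space M)"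
      using feas Suc by (auto simp: feasible_def intro: stoch_fun_measurable)
    have "markov_chain (ext_space M) borel borel borel (T (Suc (Suc m))) (T (Suc m)) (lift_rv (X j))"
      using feas by (intro markov_chain_component[OF _ j]) (auto simp: feasible_def)
    then have "mutual_info (ext_space M) borel borel (T (Suc (Suc m))) (lift_rv (X j)) \<le>
        mutual_info (ext_space M) borel borel (T (Suc m)) (lift_rv (X j))"
      using Suc meas X[OF j] by (intro E.mutual_info_data_processing) (auto intro: measurable_lift_rv)
    then show ?case
      using Suc meas by (auto intro: order_trans)
  qed
  \<comment> \<open>Since \<open>n\<close> is at least 2, \<open>Suc (n - 2)\<close> is
    \<open>n - 1\<close>, the terminal index. For \<open>n = 2\<close> this is the base case: no
    minimization takes place.\<close>
  from this[of "n - 2"] show ?thesis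
    using n by (simp add: S Suc_diff_Suc numeral_2_eq_2)
qed

theorem corollary1:
  fixes M :: "'a measure" and n :: nat and X :: "nat \<Rightarrow> 'a \<Rightarrow> 'b::polish_space"
  assumes "prob_space M"
    and "n \<ge> 2"
    and "\<And>k. k \<in> {1..n} \<Longrightarrow> X k \<in> borel_measurable M"
  shows "(\<forall>i\<in>{1..n}. \<forall>j\<in>{1..n}. i \<noteq> j \<longrightarrow> HCI M n X \<le> mutual_info M borel borel (X i) (X j)) \<and>
    HCI M n X \<le> Min {mutual_info M borel borel (X i) (X j) | i j.
      i \<in> {1..n} \<and> j \<in> {1..n} \<and> i \<noteq> j}"
proof -
  have le: "HCI M n X \<le> mutual_info M borel borel (X i) (X j)" if "i \<in> {1..n}" "j \<in> {1..n}" for i j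
  proof -
    \<comment> \<open>The outer minimum is at most its term at \<open>i\<close>; below, the inner
      minimum is at most its term at \<open>j\<close>.\<close>
    have "HCI M n X \<le> (SUP T\<in>terminal_aux M n X i.
        MIN j\<in>{1..n}. mutual_info (ext_space M) borel borel T (lift_rv (X j)))"
      unfolding HCI_def using that(1) by (intro Min_le) auto
    also have "\<dots> \<le> mutual_info M borel borel (X i) (X j)"
    \<comment> \<open>This also covers an empty set of terminal auxiliaries, where the supremum is
      0.\<close>
    proof (rule SUP_least)
      fix T assume "T \<in> terminal_aux M n X i"
      have "(MIN j\<in>{1..n}. mutual_info (ext_space M) borel borel T (lift_rv (X j))) \<le>
          mutual_info (ext_space M) borel borel T (lift_rv (X j))"
        using that(2) by (intro Min_le) auto
      also have "\<dots> \<le> mutual_info M borel borel (X i) (X j)"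
        by (rule mutual_info_terminal_le[OF assms that \<open>T \<in> _\<close>])
      finally show "(MIN j\<in>{1..n}. mutual_info (ext_space M) borel borel T (lift_rv (X j))) \<le>
          mutual_info M borel borel (X i) (X j)" .
    qed
    finally show ?thesis .
  qed
  let ?I = "{mutual_info M borel borel (X i) (X j) | i j. i \<in> {1..n} \<and> j \<in> {1..n} \<and> i \<noteq> j}"
  \<comment> \<open>\<open>Min\<close> is meaningful for finite nonempty sets only; the pair
    \<open>(1, 2)\<close>, available as \<open>n\<close> is at least 2, gives an element.\<close>
  have "finite ?I"
    by (rule finite_subset[of _ "(\<lambda>(i, j). mutual_info M borel borel (X i) (X j)) ` ({1..n} \<times> {1..n})"]) auto
  moreover have "mutual_info M borel borel (X 1) (X 2) \<in> ?I"
    using assms(2) by (intro CollectI exI[of _ 1] exI[of _ 2]) auto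
  ultimately have "HCI M n X \<le> Min ?I"
    using le by (subst Min_ge_iff) blast+
  with le show ?thesis by blast
qed

end
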